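(* Let $n\ge3$. For any $0<\beta\le2$ and any integer $m\ge2$, there exist $g\in C^m(\mathbb R^n)$ satisfying $$|g|\in\left(\tfrac{(n-2)\pi}{2},\tfrac{n\pi}{2}\right)\text{ in }\mathbb R^n,\quad |g(\infty)|>\tfrac{(n-2)\pi}{2},\quad g(x)=g(\infty)+O_m(|x|^{-\beta})\text{ as }|x|\to\infty,$$ and a real symmetric $n\times n$ matrix $A$ satisfying $$\sum_{i=1}^n\arctan\lambda_i(A)=g(\infty)\quad\text{and}\quad M(A)>1,$$ such that there is no classical solution $u$ of $\sum_{i=1}^n\arctan\lambda_i(D^2u)=g$ in $\mathbb R^n$ satisfying $$u(x)-\tfrac12x^TAx=o(1)\quad\text{as }|x|\to\infty.$$
   Context: For a real symmetric $n\times n$ matrix $N$, $\lambda_1(N),\dots,\lambda_n(N)$ denote its eigenvalues; $D^2u$ is the Hessian of $u$. $g(\infty)\in\mathbb R$ denotes the limit of $g(x)$ as $|x|\to\infty$. $g(x)=g(\infty)+O_m(|x|^{-\beta})$ means $|D^k(g-g(\infty))(x)|=O(|x|^{-\beta-k})$ as $|x|\to\infty$ for all $k=0,1,\dots,m$. For a symmetric matrix $A$ with no zero eigenvalue, $$M(A):=\min_{j,k=1,\dots,n}\left\{\frac{1+\lambda_j^2(A)}{2\lambda_k(A)}\cdot\sum_{i=1}^n\frac{\lambda_i(A)}{1+\lambda_i^2(A)}\right\}.$$ *)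

theory Defs
  imports
    "HOL-Analysis.Analysis"
    "HOL-Library.Landau_Symbols"
    "HOL-Computational_Algebra.Polynomial"
begin

definition charpoly :: "real^'n^'n \<Rightarrow> real poly" where
  "charpoly A = det (\<chi> i j. (if i = j then [:0, 1:] else 0) - [:A $ i $ j:])"

text \<open>Eigenvalues counted with multiplicity. Only real roots are counted, so for symmetric
  \<open>A\<close> this is the full multiset \<open>\<lambda>\<^sub>1(A), \<dots>, \<lambda>\<^sub>n(A)\<close>.\<close>

definition eigenvalues :: "real^'n^'n \<Rightarrow> real multiset" where
  "eigenvalues A = proots (charpoly A)"

definition arctan_sum :: "real^'n^'n \<Rightarrow> real" where
  "arctan_sum A = (\<Sum>l\<in>#eigenvalues A. arctan l)"

text \<open>Meaningful only when \<open>A\<close> has no zero eigenvalue, because of \<open>x / 0 = 0\<close>.\<close>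

definition M :: "real^'n^'n \<Rightarrow> real" where
  "M A = Min {(1 + a\<^sup>2) / (2 * b) * (\<Sum>l\<in>#eigenvalues A. l / (1 + l\<^sup>2)) | a b.
                a \<in># eigenvalues A \<and> b \<in># eigenvalues A}"

definition partial_deriv :: "'n \<Rightarrow> (real^'n \<Rightarrow> real) \<Rightarrow> real^'n \<Rightarrow> real" where
  "partial_deriv i f x = frechet_derivative f (at x) (axis i 1)"

definition partial_derivs :: "'n list \<Rightarrow> (real^'n \<Rightarrow> real) \<Rightarrow> real^'n \<Rightarrow> real" where
  "partial_derivs is f = foldr partial_deriv is f"

text \<open>The class \<open>C\<^sup>m(\<real>\<^sup>n)\<close>. Differentiability is required explicitly because
  \<^const>\<open>frechet_derivative\<close> is an arbitrary value where no derivative exists.\<close>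

definition C_class :: "nat \<Rightarrow> (real^'n \<Rightarrow> real) \<Rightarrow> bool" where
  "C_class m f \<longleftrightarrow>
     (\<forall>is. length is < m \<longrightarrow> partial_derivs is f differentiable_on UNIV) \<and>
     (\<forall>is. length is \<le> m \<longrightarrow> continuous_on UNIV (partial_derivs is f))"

definition hessian :: "(real^'n \<Rightarrow> real) \<Rightarrow> real^'n \<Rightarrow> real^'n^'n" where
  "hessian f x = (\<chi> i j. partial_derivs [i, j] f x)"

text \<open>\<open>|D\<^sup>k f(x)|\<close>, the Euclidean norm of the tensor of all \<open>k\<close>-th order partial derivatives.\<close>

definition deriv_norm :: "nat \<Rightarrow> (real^'n \<Rightarrow> real) \<Rightarrow> real^'n \<Rightarrow> real" where
  "deriv_norm k f x = L2_set (\<lambda>is. partial_derivs is f x) {is. length is = k}"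

text \<open>\<open>f = c + O\<^sub>m(|x|\<^sup>-\<^sup>\<beta>)\<close> as \<open>|x| \<rightarrow> \<infinity>\<close>.\<close>

definition eq_up_to_O_m :: "nat \<Rightarrow> real \<Rightarrow> (real^'n \<Rightarrow> real) \<Rightarrow> real \<Rightarrow> bool" where
  "eq_up_to_O_m m \<beta> f c \<longleftrightarrow>
     (\<forall>k\<le>m. deriv_norm k (\<lambda>x. f x - c) \<in> O[at_infinity](\<lambda>x. norm x powr (- \<beta> - real k)))"

definition classical_solution :: "(real^'n \<Rightarrow> real) \<Rightarrow> (real^'n \<Rightarrow> real) \<Rightarrow> bool" where
  "classical_solution g u \<longleftrightarrow> C_class 2 u \<and> (\<forall>x. arctan_sum (hessian u x) = g x)"

end

theory Submission imports Defs begin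

text \<open>
  A deviation of order \<open>|x|\<^sup>-\<^sup>2\<close> from \<open>g(\<infinity>)\<close> rules out solutions, and since \<open>\<beta> \<le> 2\<close> it is an admissible
  rate for every \<open>\<beta>\<close> in question. So one pair serves for all \<open>\<beta>\<close> and \<open>m\<close>: \<open>A = a I\<close> with
  \<open>a > 0\<close>, for which \<open>M(A) = n/2 > 1\<close>, and \<open>g(x) = g(\<infinity>) + (\<pi>/8) / (1 + |x|\<^sup>2)\<close>, where
  \<open>a = tan (g(\<infinity>)/n)\<close> and \<open>g(\<infinity>) = n\<pi>/2 - \<pi>/4\<close>.

  The phase is taken larger than \<open>(n-1)\<pi>/2\<close> everywhere. This forces the Hessian of any solution
  to have \<open>n\<close> real, nonnegative eigenvalues, on which \<open>arctan\<close> is concave. Bounding \<open>arctan\<close> by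
  its tangent at \<open>a\<close> turns the equation into a lower bound for the Laplacian
  (\<open>arctan_sum_le_trace\<close>): \<open>\<Delta>u \<ge> n a + c / (1 + |x|\<^sup>2)\<close> with \<open>c = (\<pi>/8) (1 + a\<^sup>2)\<close>.

  No function asymptotic to \<open>a|x|\<^sup>2/2\<close> satisfies this (\<open>exists_small_laplacian\<close>), because an
  excess of order \<open>|x|\<^sup>-\<^sup>2\<close> in the Laplacian makes a function grow logarithmically. Concretely,
  for \<open>K > 0\<close> the function \<open>u - a|x|\<^sup>2/2 - K ln (1 + |x|\<^sup>2)\<close> tends to \<open>-\<infinity>\<close> and so attains its
  maximum, where \<open>\<Delta>u \<le> n a + K \<Delta> ln (1 + |x|\<^sup>2) \<le> n a + 2 n K / (1 + |x|\<^sup>2)\<close>; for small \<open>K\<close> the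
  two bounds are incompatible.

  The regularity and decay of \<open>g\<close> follow from a class of functions graded by their order of growth,
  closed under differentiation with a drop of the order by one (\<open>symbol_partial_deriv\<close>).
\<close>

section \<open>Trace and eigenvalues\<close>

text \<open>
  This is used for the diagonal of a matrix as well as for its eigenvalues, so that comparing the two
  subleading coefficients identifies the trace with the sum of the eigenvalues.
\<close>

lemma monic_linear_prod:
  fixes L :: "real multiset"
  defines "P \<equiv> (\<Prod>l\<in>#L. [:- l, 1:])"
  shows "degree P = size L" and "coeff P (size L) = 1"
    and "L \<noteq> {#} \<Longrightarrow> coeff P (size L - 1) = - sum_mset L"
proof -
  have *: "degree (\<Prod>l\<in>#L. [:- l, 1:]) = size L \<and> coeff (\<Prod>l\<in>#L. [:- l, 1:]) (size L) = 1
     \<and> (L \<noteq> {#} \<longrightarrow> coeff (\<Prod>l\<in>#L. [:- l, 1:]) (size L - 1) = - sum_mset L)"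
  proof (induction L)
    case empty
    then show ?case by simp
  next
    case (add l L)
    let ?P = "\<Prod>l\<in>#L. [:- l, 1:]"
    have nz: "?P \<noteq> 0" using add by auto
    have d: "degree ([:- l, 1:] * ?P) = Suc (size L)"
      using nz add by (subst degree_mult_eq) auto
    have t: "coeff ?P (Suc (size L)) = 0" using add by (intro coeff_eq_0) auto
    have "coeff ([:- l, 1:] * ?P) (size L) = - (l + sum_mset L)"
    proof (cases "size L")
      case 0
      then show ?thesis by simp
    next
      case (Suc k)
      then show ?thesis using add by auto
    qed
    then show ?case using d t add by simp
  qed
  then show "degree P = size L" "coeff P (size L) = 1"
    "L \<noteq> {#} \<Longrightarrow> coeff P (size L - 1) = - sum_mset L"
    by (auto simp: P_def)
qed

lemma prod_proots_dvd: "(\<Prod>l\<in>#proots p. [:- l, 1:]) dvd (p :: real poly)"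
proof (induction p rule: poly_root_order_induct)
  case 0
  then show ?case by simp
next
  case (no_roots p)
  then have "proots p = {#}" by (simp add: multiset_eqI order_root)
  then show ?case by simp
next
  case (root p x n)
  then have "p \<noteq> 0" by auto
  then have "proots ([:- x, 1:] ^ n * p) = replicate_mset n x + proots p"
    by (simp add: proots_mult proots_power)
  then show ?case using root.IH by (simp add: mult_dvd_mono)
qed

lemma split_poly_eq_prod_proots:
  fixes p :: "real poly"
  assumes "size (proots p) = degree p" "lead_coeff p = 1"
  shows "p = (\<Prod>l\<in>#proots p. [:- l, 1:])"
proof -
  define P where "P = (\<Prod>l\<in>#proots p. [:- l, 1:])"
  have P: "degree P = degree p" "lead_coeff P = 1"
    using monic_linear_prod(1,2)[of "proots p"] assms(1) by (simp_all add: P_def)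
  obtain q where q: "p = P * q"
    using prod_proots_dvd[of p] unfolding P_def[symmetric] by (auto elim: dvdE)
  have "p \<noteq> 0" using assms(2) by auto
  then have nz: "P \<noteq> 0" "q \<noteq> 0" using q by auto
  have "degree p = degree P + degree q" unfolding q by (rule degree_mult_eq[OF nz])
  then have "degree q = 0" using P(1) by simp
  then obtain b where b: "q = [:b:]" by (rule degree_eq_zeroE)
  have "lead_coeff p = lead_coeff P * lead_coeff q" unfolding q by (rule lead_coeff_mult)
  then have "b = 1" using assms(2) P(2) b by simp
  then have "p = P" using q b by simp
  then show ?thesis by (simp add: P_def)
qed

text \<open>
  In the expansion of the determinant, a permutation other than the identity moves at least two
  indices, and each moved index contributes a constant factor. So every term except the diagonal one
  has degree at most \<open>n - 2\<close>. The second alternative covers \<open>n = 1\<close>, where there are no such terms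
  and \<open>degree 0 = 0\<close> would violate the strict bound.
\<close>

lemma charpoly_minus_diagonal_degree:
  fixes A :: "real^'n^'n"
  shows "degree (charpoly A - (\<Prod>i\<in>UNIV. [:- (A $ i $ i), 1:])) + 1 < CARD('n)
    \<or> charpoly A = (\<Prod>i\<in>UNIV. [:- (A $ i $ i), 1:])"
proof -
  let ?B = "(\<chi> i j. (if i = j then [:0, 1:] else 0) - [:A $ i $ j:]) :: real poly^'n^'n"
  let ?t = "\<lambda>p. of_int (sign p) * (\<Prod>i\<in>UNIV. ?B $ i $ p i)"
  let ?S = "{p. p permutes (UNIV :: 'n set)}"
  have fin: "finite ?S" by (rule finite_permutations) simp
  have id: "id \<in> ?S" by (simp add: permutes_id)
  have deg: "degree (?t p) + 2 \<le> CARD('n)" if p: "p \<in> ?S - {id}" for p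
  proof -
    obtain i where i: "p i \<noteq> i" using p by (auto simp: fun_eq_iff)
    have inj: "inj p" using p permutes_inj by blast
    have i2: "p (p i) \<noteq> p i" using i inj by (auto dest: injD)
    have "degree (\<Prod>i\<in>UNIV. ?B $ i $ p i) \<le> (\<Sum>k\<in>UNIV. degree (?B $ k $ p k))"
      by (rule order_trans[OF degree_prod_sum_le]) auto
    also have "\<dots> \<le> (\<Sum>k\<in>UNIV. if k \<in> {i, p i} then 0 else 1)"
    proof (rule sum_mono)
      fix k show "degree (?B $ k $ p k) \<le> (if k \<in> {i, p i} then 0 else 1)"
        using i i2 by (cases "p k = k") auto
    qed
    also have "\<dots> = card (UNIV - {i, p i})"
      by (simp del: insert_iff add: sum.If_cases Compl_eq_Diff_UNIV)
    also have "\<dots> = CARD('n) - 2"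
      using i by (subst card_Diff_subset) auto
    finally have "degree (\<Prod>i\<in>UNIV. ?B $ i $ p i) \<le> CARD('n) - 2" .
    moreover have "CARD('n) \<ge> 2"
      using i card_mono[of UNIV "{i, p i}"] by auto
    moreover have "degree (?t p) \<le> degree (\<Prod>i\<in>UNIV. ?B $ i $ p i)"
      by (simp add: sign_def)
    ultimately show ?thesis by simp
  qed
  have eq: "charpoly A - (\<Prod>i\<in>UNIV. [:- (A $ i $ i), 1:]) = (\<Sum>p\<in>?S - {id}. ?t p)"
    unfolding charpoly_def det_def by (subst sum.remove[OF fin id]) simp
  show ?thesis
  proof (cases "?S - {id} = {}")
    case True
    show ?thesis using eq unfolding True by simp
  next
    case False
    then have n: "CARD('n) \<ge> 2" using deg by fastforce
    have "degree (\<Sum>p\<in>?S - {id}. ?t p) \<le> CARD('n) - 2"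
      using fin deg by (intro degree_sum_le) fastforce+
    then show ?thesis using n unfolding eq by (intro disjI1) linarith
  qed
qed

lemma charpoly_top_coeffs:
  fixes A :: "real^'n^'n"
  shows "degree (charpoly A) = CARD('n)" "lead_coeff (charpoly A) = 1"
    "coeff (charpoly A) (CARD('n) - 1) = - trace A"
proof -
  let ?L = "image_mset (\<lambda>i. A $ i $ i) (mset_set (UNIV :: 'n set))"
  let ?P = "\<Prod>i\<in>UNIV. [:- (A $ i $ i), 1:]"
  have P: "?P = (\<Prod>l\<in>#?L. [:- l, 1:])"
    by (simp add: prod_unfold_prod_mset image_mset.compositionality o_def)
  have ne: "?L \<noteq> {#}" by (simp add: mset_set_empty_iff)
  have s: "size ?L = CARD('n)" by simp
  have tr: "sum_mset ?L = trace A" by (simp add: trace_def sum_unfold_sum_mset)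
  note m = monic_linear_prod[of ?L, folded P, unfolded s tr]
  have top: "coeff (charpoly A) k = coeff ?P k" if "k + 1 \<ge> CARD('n)" for k
    using charpoly_minus_diagonal_degree[of A]
  proof
    assume "degree (charpoly A - ?P) + 1 < CARD('n)"
    then have "coeff (charpoly A - ?P) k = 0" using that by (intro coeff_eq_0) simp
    then show ?thesis by simp
  qed simp
  show d: "degree (charpoly A) = CARD('n)"
  proof (rule antisym)
    show "degree (charpoly A) \<le> CARD('n)"
      using top m(1) by (intro degree_le) (auto intro!: coeff_eq_0)
    show "CARD('n) \<le> degree (charpoly A)"
      using top m(2) by (intro le_degree) simp
  qed
  show "lead_coeff (charpoly A) = 1" using top m(2) d by simp
  show "coeff (charpoly A) (CARD('n) - 1) = - trace A" using top m(3) ne by simp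
qed

lemma size_eigenvalues_le: "size (eigenvalues (A :: real^'n^'n)) \<le> CARD('n)"
  unfolding eigenvalues_def using size_proots_le[of "charpoly A"] by (simp add: charpoly_top_coeffs)

text \<open>
  The hypothesis says that all complex eigenvalues are real, so the characteristic polynomial is the
  product of the corresponding linear factors, whose subleading coefficient is minus their sum.
\<close>

lemma sum_eigenvalues_eq_trace:
  fixes A :: "real^'n^'n"
  assumes "size (eigenvalues A) = CARD('n)"
  shows "sum_mset (eigenvalues A) = trace A"
proof -
  have "charpoly A = (\<Prod>l\<in>#eigenvalues A. [:- l, 1:])"
    using assms charpoly_top_coeffs(1,2)[of A] unfolding eigenvalues_def
    by (intro split_poly_eq_prod_proots) (simp_all only:)
  moreover have "eigenvalues A \<noteq> {#}" using assms by auto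
  ultimately show ?thesis
    using monic_linear_prod(3)[of "eigenvalues A"] charpoly_top_coeffs(3)[of A] assms by simp
qed

lemma eigenvalues_mat: "eigenvalues (mat a :: real^'n^'n) = replicate_mset CARD('n) a"
proof -
  have "charpoly (mat a :: real^'n^'n) = [:- a, 1:] ^ CARD('n)"
    unfolding charpoly_def by (subst det_diagonal) (auto simp: mat_def)
  then show ?thesis by (simp add: eigenvalues_def proots_power)
qed

section \<open>Concavity of the arctangent sum\<close>

lemma arctan_le_tangent:
  fixes a l :: real
  assumes "0 \<le> a" "0 \<le> l"
  shows "arctan l \<le> arctan a + (l - a) / (1 + a\<^sup>2)"
proof (cases "a \<le> l")
  case True
  then show ?thesis
  proof (cases "a = l")
    case False
    with True have "a < l" by simp
    then obtain z where z: "a < z" "z < l" "arctan l - arctan a = (l - a) * inverse (1 + z\<^sup>2)"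
      using MVT2[of a l arctan "\<lambda>z. inverse (1 + z\<^sup>2)"] DERIV_arctan by blast
    have "inverse (1 + z\<^sup>2) \<le> inverse (1 + a\<^sup>2)"
      using z assms by (intro le_imp_inverse_le) (auto intro!: power_mono add_pos_nonneg)
    then have "(l - a) * inverse (1 + z\<^sup>2) \<le> (l - a) * inverse (1 + a\<^sup>2)"
      using \<open>a < l\<close> by (intro mult_left_mono) auto
    then show ?thesis using z by (simp add: field_simps)
  qed simp
next
  case False
  then have "l < a" by simp
  then obtain z where z: "l < z" "z < a" "arctan a - arctan l = (a - l) * inverse (1 + z\<^sup>2)"
    using MVT2[of l a arctan "\<lambda>z. inverse (1 + z\<^sup>2)"] DERIV_arctan by blast
  have "inverse (1 + a\<^sup>2) \<le> inverse (1 + z\<^sup>2)"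
    using z assms by (intro le_imp_inverse_le) (auto intro!: power_mono add_pos_nonneg)
  then have "(a - l) * inverse (1 + a\<^sup>2) \<le> (a - l) * inverse (1 + z\<^sup>2)"
    using \<open>l < a\<close> by (intro mult_left_mono) auto
  then have "arctan l \<le> arctan a - (a - l) * inverse (1 + a\<^sup>2)" using z(3) by linarith
  also have "\<dots> = arctan a + (l - a) / (1 + a\<^sup>2)" by (simp add: divide_inverse left_diff_distrib)
  finally show ?thesis .
qed

lemma sum_mset_arctan_le: "(\<Sum>l\<in>#L. arctan l) \<le> real (size L) * (pi / 2)"
proof (induction L)
  case (add l L)
  then show ?case using arctan_ubound[of l] by (simp add: algebra_simps)
qed simp

text \<open>
  Each summand is below \<open>\<pi>/2\<close>. A phase above \<open>(n-1)\<pi>/2\<close> therefore leaves no room for fewer than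
  \<open>n\<close> real eigenvalues, nor for a negative one, and \<open>arctan\<close> lies below its tangent at \<open>a\<close> on
  the whole spectrum.
\<close>

lemma arctan_sum_le_trace:
  fixes N :: "real^'n^'n"
  assumes big: "arctan_sum N > (real CARD('n) - 1) * pi / 2" and a: "0 \<le> a"
  shows "arctan_sum N \<le> real CARD('n) * arctan a + (trace N - real CARD('n) * a) / (1 + a\<^sup>2)"
proof -
  let ?E = "eigenvalues N"
  have size: "size ?E = CARD('n)"
  proof (rule ccontr)
    assume "size ?E \<noteq> CARD('n)"
    then have "real (size ?E) \<le> real CARD('n) - 1" using size_eigenvalues_le[of N] by simp
    then have "real (size ?E) * (pi / 2) \<le> (real CARD('n) - 1) * (pi / 2)"
      by (intro mult_right_mono) auto
    then show False using big sum_mset_arctan_le[of ?E] unfolding arctan_sum_def by linarith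
  qed
  have pos: "0 \<le> l" if l: "l \<in># ?E" for l
  proof (rule ccontr)
    assume "\<not> 0 \<le> l"
    then have neg: "arctan l < 0" by simp
    obtain L where L: "?E = add_mset l L" using multi_member_split[OF l] by blast
    then have "real (size L) = real CARD('n) - 1" using size by simp
    then have "arctan_sum N \<le> arctan l + (real CARD('n) - 1) * (pi / 2)"
      using sum_mset_arctan_le[of L] unfolding arctan_sum_def L by simp
    then show False using big neg by linarith
  qed
  have "arctan_sum N \<le> (\<Sum>l\<in>#?E. arctan a + (l - a) / (1 + a\<^sup>2))"
    unfolding arctan_sum_def using pos a by (intro sum_mset_mono arctan_le_tangent) auto
  also have "(\<Sum>l\<in>#L. arctan a + (l - a) / (1 + a\<^sup>2))
      = real (size L) * arctan a + (sum_mset L - real (size L) * a) / (1 + a\<^sup>2)" for L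
    by (induction L) (simp_all add: algebra_simps add_divide_distrib diff_divide_distrib)
  finally show ?thesis using size sum_eigenvalues_eq_trace[OF size] by simp
qed

section \<open>Second derivatives at a maximum\<close>

text \<open>
  Only the derivative at \<open>0\<close> of \<open>f'\<close> is assumed to exist: were it positive, \<open>f'\<close> would be positive
  just to the right of its zero, and \<open>f\<close> would increase there.
\<close>

lemma second_derivative_at_max:
  fixes f f' :: "real \<Rightarrow> real"
  assumes f: "\<And>t. (f has_real_derivative f' t) (at t)"
    and f': "(f' has_real_derivative D) (at 0)"
    and max: "\<And>t. f t \<le> f 0"
  shows "D \<le> 0"
proof (rule ccontr)
  assume "\<not> D \<le> 0"
  then obtain d where d: "d > 0" "\<And>h. h > 0 \<Longrightarrow> h < d \<Longrightarrow> f' 0 < f' (0 + h)"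
    using DERIV_pos_inc_right[OF f'] by auto
  have "f' 0 = 0" using DERIV_local_max[OF f, of 1 0] max by simp
  moreover obtain z where "0 < z" "z < d / 2" "f (d / 2) - f 0 = (d / 2 - 0) * f' z"
    using MVT2[of 0 "d / 2" f f'] f d(1) by auto
  moreover have "f' z > f' 0" using d \<open>0 < z\<close> \<open>z < d / 2\<close> by simp
  ultimately have "f (d / 2) - f 0 > 0" using d(1) by (metis diff_zero half_gt_zero mult_pos_pos)
  then show False using max[of "d / 2"] by simp
qed

lemma partial_deriv_along_axis:
  fixes f :: "real^'n \<Rightarrow> real"
  assumes "f differentiable (at (x + t *\<^sub>R axis i 1))"
  shows "((\<lambda>t. f (x + t *\<^sub>R axis i 1)) has_real_derivative
          partial_deriv i f (x + t *\<^sub>R axis i 1)) (at t)"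
proof -
  let ?y = "x + t *\<^sub>R axis i 1"
  have F: "(f has_derivative frechet_derivative f (at ?y)) (at ?y)"
    using assms by (simp add: frechet_derivative_works)
  have "((\<lambda>t. x + t *\<^sub>R axis i 1) has_derivative (\<lambda>h. h *\<^sub>R axis i 1)) (at t)"
    by (auto intro!: derivative_eq_intros)
  then have "((\<lambda>t. f (x + t *\<^sub>R axis i 1)) has_derivative
      (\<lambda>h. frechet_derivative f (at ?y) (h *\<^sub>R axis i 1))) (at t)"
    using F by (rule has_derivative_compose)
  moreover have "frechet_derivative f (at ?y) (h *\<^sub>R axis i 1) = partial_deriv i f ?y * h" for h
    using linear_frechet_derivative[OF assms] by (simp add: linear_scale partial_deriv_def)
  ultimately show ?thesis by (simp add: has_field_derivative_def)
qed

text \<open>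
  The second derivative test along the \<open>i\<close>-th coordinate line. On it, \<open>1 + |x|\<^sup>2\<close> is a quadratic
  polynomial \<open>q\<close>, and the second derivative of \<open>ln q\<close> is \<open>2/q - (q'/q)\<^sup>2 \<le> 2/q\<close>.
\<close>

lemma hessian_diagonal_at_max:
  fixes u :: "real^'n \<Rightarrow> real"
  assumes u: "C_class 2 u" and K: "0 \<le> K"
    and max: "\<And>x. u x - a / 2 * (x \<bullet> x) - K * ln (1 + x \<bullet> x)
                  \<le> u x0 - a / 2 * (x0 \<bullet> x0) - K * ln (1 + x0 \<bullet> x0)"
  shows "hessian u x0 $ i $ i \<le> a + 2 * K / (1 + x0 \<bullet> x0)"
proof -
  let ?e = "axis i 1 :: real^'n"
  define s b where "s = x0 \<bullet> x0" and "b = x0 $ i"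
  define q where "q t = 1 + s + 2 * t * b + t\<^sup>2" for t
  have line: "(x0 + t *\<^sub>R ?e) \<bullet> (x0 + t *\<^sub>R ?e) = q t - 1" for t :: real
    by (simp add: q_def s_def b_def inner_add inner_axis inner_axis' power2_eq_square algebra_simps)
  have q: "q t > 0" for t
    using line[of t] inner_ge_zero[of "x0 + t *\<^sub>R ?e"] by linarith
  have q0: "q 0 = 1 + s" by (simp add: q_def)
  have d0: "partial_derivs [] u differentiable_on UNIV" "partial_derivs [i] u differentiable_on UNIV"
    using u unfolding C_class_def by (metis list.size(3) zero_less_numeral,
        metis One_nat_def length_Cons list.size(3) one_less_numeral_iff semiring_norm(76))
  have du: "u differentiable (at y)" "partial_deriv i u differentiable (at y)" for y
    using d0 by (simp_all add: partial_derivs_def differentiable_on_def)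
  let ?f = "\<lambda>t. u (x0 + t *\<^sub>R ?e) - a / 2 * (q t - 1) - K * ln (q t)"
  let ?f' = "\<lambda>t. partial_deriv i u (x0 + t *\<^sub>R ?e) - a * (b + t) - K * (2 * b + 2 * t) / q t"
  have dq: "(q has_real_derivative 2 * b + 2 * t) (at t)" for t
    unfolding q_def by (auto intro!: derivative_eq_intros)
  have "(?f has_real_derivative ?f' t) (at t)" for t
    using q[of t]
    by (auto intro!: derivative_eq_intros partial_deriv_along_axis du dq simp: field_simps)
  moreover have "(?f' has_real_derivative hessian u x0 $ i $ i - a
      - K * (2 * q 0 - (2 * b) * (2 * b)) / (q 0)\<^sup>2) (at 0)"
  proof -
    have "((\<lambda>t. partial_deriv i u (x0 + t *\<^sub>R ?e)) has_real_derivative hessian u x0 $ i $ i) (at 0)"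
      using partial_deriv_along_axis[OF du(2), where x = x0 and t = 0 and i = i]
      by (simp add: hessian_def partial_derivs_def)
    then show ?thesis using q[of 0]
      by (auto intro!: derivative_eq_intros dq simp: field_simps power2_eq_square)
  qed
  moreover have "?f t \<le> ?f 0" for t
    using max[of "x0 + t *\<^sub>R ?e"] line[of t] line[of 0] by simp
  ultimately have "hessian u x0 $ i $ i - a - K * (2 * q 0 - (2 * b) * (2 * b)) / (q 0)\<^sup>2 \<le> 0"
    by (rule second_derivative_at_max)
  moreover have "K * (2 * q 0 - (2 * b) * (2 * b)) / (q 0)\<^sup>2 \<le> K * (2 * q 0) / (q 0)\<^sup>2"
    using K by (intro divide_right_mono mult_left_mono) auto
  moreover have "K * (2 * q 0) / (q 0)\<^sup>2 = 2 * K / (1 + s)"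
    using q[of 0] by (simp add: power2_eq_square flip: q0)
  ultimately show ?thesis by (simp add: s_def)
qed

lemma one_plus_inner_pos: "1 + x \<bullet> x > 0" for x :: "'a::real_inner"
  by (simp add: add_pos_nonneg)

lemma filterlim_one_plus_inner:
  "filterlim (\<lambda>x :: 'a::real_inner. 1 + x \<bullet> x) at_top at_infinity"
proof -
  have "filterlim (\<lambda>x :: 'a. 1 + norm x ^ 2) at_top at_infinity"
    by (intro filterlim_tendsto_add_at_top[OF tendsto_const] filterlim_pow_at_top
        filterlim_norm_at_top) simp
  then show ?thesis by (simp add: power2_norm_eq_inner)
qed

text \<open>
  Subtracting a multiple of \<open>ln (1 + |x|\<^sup>2)\<close> forces a maximum to exist, since the logarithm
  outgrows the vanishing error at infinity, and its own Laplacian is of the same order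
  \<open>|x|\<^sup>-\<^sup>2\<close> as the excess, so a small multiple costs less than the excess.
\<close>

lemma exists_small_laplacian:
  fixes u :: "real^'n \<Rightarrow> real"
  assumes u: "C_class 2 u" and c: "0 < c"
    and asym: "(\<lambda>x. u x - a / 2 * (x \<bullet> x)) \<in> o[at_infinity](\<lambda>_. 1)"
  shows "\<exists>x. trace (hessian u x) < real CARD('n) * a + c / (1 + x \<bullet> x)"
proof -
  \<comment> \<open>The test at a maximum gives an excess of at most \<open>2 n K / (1 + |x|\<^sup>2)\<close>, which is half of the
    excess in question; any smaller positive constant would do.\<close>
  define K where "K = c / (4 * real CARD('n))"
  have K: "0 < K" using c by (simp add: K_def)
  define f where "f x = u x - a / 2 * (x \<bullet> x) - K * ln (1 + x \<bullet> x)" for x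
  have "continuous_on UNIV (partial_derivs [] u)"
    using u unfolding C_class_def by (metis list.size(3) zero_le)
  then have cu: "continuous_on UNIV u" by (simp add: partial_derivs_def)
  have nz: "1 + x \<bullet> x \<noteq> 0" for x :: "real^'n"
    using one_plus_inner_pos[of x] by simp
  have cf: "continuous_on S f" for S
    unfolding f_def using nz
    by (intro continuous_intros continuous_on_subset[OF cu]) auto
  have "eventually (\<lambda>x. norm (u x - a / 2 * (x \<bullet> x)) \<le> 1) at_infinity"
    using landau_o.smallD[OF asym, of 1] by simp
  moreover have "eventually (\<lambda>x :: real^'n. ln (1 + x \<bullet> x) \<ge> (1 - f 0) / K) at_infinity"
    using filterlim_compose[OF ln_at_top filterlim_one_plus_inner] unfolding filterlim_at_top by blast
  ultimately have "eventually (\<lambda>x. f x \<le> f 0) at_infinity"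
  proof eventually_elim
    case (elim x)
    then have "K * ln (1 + x \<bullet> x) \<ge> 1 - f 0" using K by (simp add: field_simps)
    then show ?case using elim(1) unfolding f_def[of x] by (simp add: abs_le_iff)
  qed
  then obtain R where R: "\<And>x. norm x \<ge> R \<Longrightarrow> f x \<le> f 0"
    by (auto simp: eventually_at_infinity)
  obtain x0 where x0: "x0 \<in> cball 0 \<bar>R\<bar>" "\<And>y. y \<in> cball 0 \<bar>R\<bar> \<Longrightarrow> f y \<le> f x0"
    using continuous_attains_sup[of "cball 0 \<bar>R\<bar>" f] cf by auto
  have max: "f x \<le> f x0" for x
  proof (cases "x \<in> cball 0 \<bar>R\<bar>")
    case False
    then have "f x \<le> f 0" by (intro R) auto
    also have "f 0 \<le> f x0" by (intro x0) simp
    finally show ?thesis .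
  qed (rule x0)
  have "hessian u x0 $ i $ i \<le> a + 2 * K / (1 + x0 \<bullet> x0)" for i
    using hessian_diagonal_at_max[OF u less_imp_le[OF K]] max unfolding f_def by blast
  then have "trace (hessian u x0) \<le> real CARD('n) * (a + 2 * K / (1 + x0 \<bullet> x0))"
    unfolding trace_def by (rule sum_bounded_above)
  also have "\<dots> = real CARD('n) * a + (c / 2) / (1 + x0 \<bullet> x0)"
  proof -
    have "real CARD('n) * (2 * K / Q) = (c / 2) / Q" for Q by (simp add: K_def)
    then show ?thesis by (simp only: distrib_left)
  qed
  also have "\<dots> < real CARD('n) * a + c / (1 + x0 \<bullet> x0)"
    using c by (intro add_strict_left_mono divide_strict_right_mono) (auto intro: add_pos_nonneg)
  finally show ?thesis by blast
qed

section \<open>Functions with symbol-type decay\<close>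

text \<open>
  The functions of order \<open>s\<close>, generated just richly enough to contain \<open>g\<close> and to be closed under
  differentiation: up to \<open>weaken\<close>, they are combinations of terms
  \<open>P(x) (1 + |x|\<^sup>2)\<^sup>-\<^sup>j\<close> with \<open>P\<close> a polynomial of degree at most \<open>s + 2 j\<close>. The rule \<open>zero\<close> makes
  the derivative of a constant fall into every order.
\<close>

inductive symbol :: "int \<Rightarrow> (real^'n \<Rightarrow> real) \<Rightarrow> bool" where
  const: "symbol 0 (\<lambda>_. c)"
| coord: "symbol 1 (\<lambda>x. x $ i)"
| bracket: "symbol (- 2) (\<lambda>x. inverse (1 + x \<bullet> x))"
| add: "symbol s f \<Longrightarrow> symbol s g \<Longrightarrow> symbol s (\<lambda>x. f x + g x)"
| mult: "symbol s f \<Longrightarrow> symbol r g \<Longrightarrow> symbol (s + r) (\<lambda>x. f x * g x)"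
| weaken: "symbol s f \<Longrightarrow> s \<le> r \<Longrightarrow> symbol r f"
| zero: "symbol s (\<lambda>_. 0)"

lemma partial_deriv_eqI:
  "(f has_derivative f') (at x) \<Longrightarrow> partial_deriv i f x = f' (axis i 1)"
  by (simp add: partial_deriv_def frechet_derivative_at[symmetric])

text \<open>
  The order drops because it does so on the generators; for the third one,
  \<open>\<partial>\<^sub>i (1 + |x|\<^sup>2)\<^sup>-\<^sup>1 = -2 x\<^sub>i (1 + |x|\<^sup>2)\<^sup>-\<^sup>2\<close> has order \<open>1 - 4 = -3\<close>. The Leibniz rule preserves this.
\<close>

lemma symbol_partial_deriv:
  fixes f :: "real^'n \<Rightarrow> real"
  shows "symbol s f \<Longrightarrow> (\<forall>x. f differentiable (at x)) \<and> symbol (s - 1) (partial_deriv i f)"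
proof (induction rule: symbol.induct)
  case (const c)
  have "partial_deriv i (\<lambda>_. c) = (\<lambda>_. 0)"
    by (rule ext, rule partial_deriv_eqI[THEN trans], rule has_derivative_const) simp
  then show ?case by (simp add: symbol.zero)
next
  case (coord j)
  have D: "((\<lambda>x. x $ j) has_derivative (\<lambda>h. h $ j)) (at x)" for x :: "real^'n"
    by (rule bounded_linear_imp_has_derivative) (rule bounded_linear_vec_nth)
  have "partial_deriv i (\<lambda>x. x $ j) = (\<lambda>_. axis i 1 $ j)"
    by (rule ext, rule partial_deriv_eqI[OF D])
  then show ?case using D by (auto simp: differentiable_def intro: symbol.const)
next
  case bracket
  let ?q = "\<lambda>x :: real^'n. inverse (1 + x \<bullet> x)"
  have D: "(?q has_derivative (\<lambda>h. - 2 * (x \<bullet> h) * (?q x * ?q x))) (at x)" for x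
    using one_plus_inner_pos[of x]
    by (auto intro!: derivative_eq_intros simp: inner_commute algebra_simps)
  have "partial_deriv i ?q = (\<lambda>x. (- 2 * x $ i) * (?q x * ?q x))"
    by (rule ext, subst partial_deriv_eqI[OF D]) (simp add: inner_axis)
  moreover have "symbol ((0 + 1) + (- 2 + - 2)) (\<lambda>x. (- 2 * x $ i) * (?q x * ?q x))"
    by (intro symbol.mult symbol.const symbol.coord symbol.bracket)
  ultimately show ?case using D by (auto simp: differentiable_def)
next
  case (add s f g)
  have D: "((\<lambda>x. f x + g x) has_derivative
      (\<lambda>h. frechet_derivative f (at x) h + frechet_derivative g (at x) h)) (at x)" for x
    using add.IH by (intro has_derivative_add) (simp_all add: frechet_derivative_works)
  have "partial_deriv i (\<lambda>x. f x + g x) = (\<lambda>x. partial_deriv i f x + partial_deriv i g x)"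
    by (rule ext, subst partial_deriv_eqI[OF D]) (simp add: partial_deriv_def)
  then show ?case using add.IH by (auto intro: symbol.add)
next
  case (mult s f r g)
  have D: "((\<lambda>x. f x * g x) has_derivative
      (\<lambda>h. f x * frechet_derivative g (at x) h + frechet_derivative f (at x) h * g x)) (at x)" for x
    using mult.IH by (intro has_derivative_mult) (simp_all add: frechet_derivative_works)
  have "partial_deriv i (\<lambda>x. f x * g x) = (\<lambda>x. f x * partial_deriv i g x + partial_deriv i f x * g x)"
    by (rule ext, subst partial_deriv_eqI[OF D]) (simp add: partial_deriv_def)
  moreover have "symbol (s + r - 1) (\<lambda>x. f x * partial_deriv i g x + partial_deriv i f x * g x)"
    using mult symbol.mult[of s f "r - 1" "partial_deriv i g"]
      symbol.mult[of "s - 1" "partial_deriv i f" r g]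
    by (intro symbol.add) (simp_all add: algebra_simps)
  ultimately show ?case using mult.IH by auto
next
  case (weaken s f r)
  then show ?case using symbol.weaken[of "s - 1" "partial_deriv i f" "r - 1"] by auto
next
  case (zero s)
  have "partial_deriv i (\<lambda>_. 0) = (\<lambda>_. 0)"
    by (rule ext, rule partial_deriv_eqI[THEN trans], rule has_derivative_const) simp
  then show ?case by (simp add: symbol.zero)
qed

lemma symbol_partial_derivs:
  assumes "symbol s f"
  shows "symbol (s - int (length is)) (partial_derivs is f)"
proof (induction "is")
  case Nil
  then show ?case using assms by (simp add: partial_derivs_def)
next
  case (Cons i "is")
  then show ?case
    using symbol_partial_deriv[of "s - int (length is)" "partial_derivs is f" i]
    by (simp add: partial_derivs_def algebra_simps)
qed

lemma symbol_C_class: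
  assumes "symbol s f"
  shows "C_class m f"
proof -
  have "partial_derivs is f differentiable_on UNIV" for "is"
    using symbol_partial_deriv[OF symbol_partial_derivs[OF assms]]
    by (auto simp: differentiable_on_def)
  then show ?thesis
    unfolding C_class_def using differentiable_imp_continuous_on by blast
qed

text \<open>
  The bound is in powers of \<open>1 + |x|\<^sup>2\<close> rather than \<open>|x|\<close>, so that it holds up to the origin and
  is monotone in \<open>s\<close>, as the rule \<open>weaken\<close> demands.
\<close>

lemma symbol_bound:
  fixes f :: "real^'n \<Rightarrow> real"
  shows "symbol s f \<Longrightarrow> \<exists>C \<ge> 0. \<forall>x. \<bar>f x\<bar> \<le> C * (1 + x \<bullet> x) powr (s / 2)"
proof (induction rule: symbol.induct)
  case (const c)
  have "1 + x \<bullet> x \<noteq> 0" for x :: "real^'n"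
    using one_plus_inner_pos[of x] by simp
  then show ?case by (intro exI[of _ "\<bar>c\<bar>"]) simp
next
  case (coord i)
  have "\<bar>x $ i\<bar> \<le> (1 + x \<bullet> x) powr (1 / 2)" for x :: "real^'n"
  proof -
    have "\<bar>x $ i\<bar> \<le> sqrt (x \<bullet> x)"
      using component_le_norm_cart[of x i] by (simp add: norm_eq_sqrt_inner)
    also have "\<dots> \<le> sqrt (1 + x \<bullet> x)" by simp
    finally show ?thesis using one_plus_inner_pos[of x] by (simp add: powr_half_sqrt)
  qed
  then show ?case by (intro exI[of _ 1]) simp
next
  case bracket
  show ?case using one_plus_inner_pos
    by (intro exI[of _ 1]) (auto simp: powr_minus powr_one less_imp_le)
next
  case (add s f g)
  then obtain C1 C2 where C: "C1 \<ge> 0" "C2 \<ge> 0"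
    "\<And>x. \<bar>f x\<bar> \<le> C1 * (1 + x \<bullet> x) powr (s / 2)" "\<And>x. \<bar>g x\<bar> \<le> C2 * (1 + x \<bullet> x) powr (s / 2)"
    by blast
  have "\<bar>f x + g x\<bar> \<le> (C1 + C2) * (1 + x \<bullet> x) powr (s / 2)" for x
    using C(3)[of x] C(4)[of x] abs_triangle_ineq[of "f x" "g x"] by (simp add: algebra_simps)
  then show ?case using C by (intro exI[of _ "C1 + C2"]) simp
next
  case (mult s f r g)
  then obtain C1 C2 where C: "C1 \<ge> 0" "C2 \<ge> 0"
    "\<And>x. \<bar>f x\<bar> \<le> C1 * (1 + x \<bullet> x) powr (s / 2)" "\<And>x. \<bar>g x\<bar> \<le> C2 * (1 + x \<bullet> x) powr (r / 2)"
    by blast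
  have "\<bar>f x * g x\<bar> \<le> (C1 * C2) * (1 + x \<bullet> x) powr ((s + r) / 2)" for x
  proof -
    have "\<bar>f x * g x\<bar> \<le> (C1 * (1 + x \<bullet> x) powr (s / 2)) * (C2 * (1 + x \<bullet> x) powr (r / 2))"
      unfolding abs_mult using C by (intro mult_mono) auto
    then show ?thesis by (simp add: add_divide_distrib powr_add algebra_simps)
  qed
  then show ?case using C by (intro exI[of _ "C1 * C2"]) simp
next
  case (weaken s f r)
  then obtain C where C: "C \<ge> 0" "\<And>x. \<bar>f x\<bar> \<le> C * (1 + x \<bullet> x) powr (s / 2)" by blast
  have "C * (1 + x \<bullet> x) powr (s / 2) \<le> C * (1 + x \<bullet> x) powr (r / 2)" for x :: "real^'n"
    using C(1) weaken.hyps by (intro mult_left_mono powr_mono) auto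
  then show ?case using C by (meson order_trans)
qed auto

lemma symbol_decay:
  fixes f :: "real^'n \<Rightarrow> real"
  assumes f: "symbol s f" and "s \<le> 0" and "real_of_int s \<le> r"
  shows "f \<in> O[at_infinity](\<lambda>x. norm x powr r)"
proof -
  obtain C where C: "C \<ge> 0" "\<And>x. \<bar>f x\<bar> \<le> C * (1 + x \<bullet> x) powr (s / 2)"
    using symbol_bound[OF f] by blast
  have "\<bar>f x\<bar> \<le> C * norm x powr r" if "1 \<le> norm x" for x
  proof -
    have "(1 + x \<bullet> x) powr (s / 2) \<le> (norm x ^ 2) powr (s / 2)"
      using \<open>s \<le> 0\<close> that by (intro powr_mono2') (auto simp: power2_norm_eq_inner)
    also have "\<dots> = norm x powr s"
      using that by (simp add: powr_powr flip: powr_numeral)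
    also have "\<dots> \<le> norm x powr r"
      using that assms(3) by (intro powr_mono) auto
    finally show ?thesis using C by (meson mult_left_mono order_trans)
  qed
  then show ?thesis
    by (intro bigoI[of _ C]) (auto simp: eventually_at_infinity intro!: exI[of _ 1])
qed

lemma symbol_deriv_norm_decay:
  fixes f :: "real^'n \<Rightarrow> real"
  assumes f: "symbol s f" and s: "s \<le> 0" and r: "real_of_int s \<le> r"
  shows "deriv_norm k f \<in> O[at_infinity](\<lambda>x. norm x powr (r - real k))"
proof -
  let ?I = "{is :: 'n list. length is = k}"
  have "(\<lambda>x. \<Sum>is\<in>?I. \<bar>partial_derivs is f x\<bar>) \<in> O[at_infinity](\<lambda>x. norm x powr (r - real k))"
  proof (rule big_sum_in_bigo)
    fix "is" assume "is \<in> ?I"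
    then have "partial_derivs is f \<in> O[at_infinity](\<lambda>x. norm x powr (r - real k))"
      using s r by (intro symbol_decay[OF symbol_partial_derivs[OF f]]) auto
    then show "(\<lambda>x. \<bar>partial_derivs is f x\<bar>) \<in> O[at_infinity](\<lambda>x. norm x powr (r - real k))"
      by simp
  qed
  moreover have "deriv_norm k f \<in> O[at_infinity](\<lambda>x. \<Sum>is\<in>?I. \<bar>partial_derivs is f x\<bar>)"
    by (intro bigoI[of _ 1] always_eventually allI)
      (simp add: deriv_norm_def L2_set_le_sum_abs L2_set_nonneg sum_nonneg)
  ultimately show ?thesis by (rule landau_o.big_trans[rotated])
qed

section \<open>The counterexample\<close>

theorem theorem1p3:
  fixes \<beta> :: real and m :: nat
  assumes "CARD('n::finite) \<ge> 3"
    and "0 < \<beta>" and "\<beta> \<le> 2"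
    and "m \<ge> 2"
  shows "\<exists>(g :: real^'n \<Rightarrow> real) (g_inf :: real) (A :: real^'n^'n).
    C_class m g \<and>
    (\<forall>x. \<bar>g x\<bar> \<in> {(real CARD('n) - 2) * pi / 2 <..< real CARD('n) * pi / 2}) \<and>
    (g \<longlongrightarrow> g_inf) at_infinity \<and>
    \<bar>g_inf\<bar> > (real CARD('n) - 2) * pi / 2 \<and>
    eq_up_to_O_m m \<beta> g g_inf \<and>
    transpose A = A \<and>
    arctan_sum A = g_inf \<and>
    0 \<notin># eigenvalues A \<and>
    M A > 1 \<and>
    \<not> (\<exists>u :: real^'n \<Rightarrow> real.
          classical_solution g u \<and>
          (\<lambda>x. u x - 1 / 2 * (x \<bullet> (A *v x))) \<in> o[at_infinity](\<lambda>_. 1))"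
proof -
  define n where "n = real CARD('n)"
  have n: "n \<ge> 3" using assms(1) by (simp add: n_def)
  \<comment> \<open>The common phase \<open>\<theta>\<close> of the \<open>n\<close> eigenvalues is so close to \<open>\<pi>/2\<close> that
    \<open>n \<theta> = n \<pi>/2 - \<pi>/4\<close> exceeds \<open>(n-1) \<pi>/2\<close>, while room for a perturbation of size \<open>\<pi>/8\<close> remains.\<close>
  define \<theta> where "\<theta> = pi / 2 - pi / (4 * n)"
  define a where "a = tan \<theta>"
  define g_inf where "g_inf = n * \<theta>"
  define f :: "real^'n \<Rightarrow> real" where "f x = pi / 8 * inverse (1 + x \<bullet> x)" for x
  define g where "g x = g_inf + f x" for x
  define A :: "real^'n^'n" where "A = mat a"
  have "pi / (4 * n) < pi / 2" "pi / (4 * n) > 0" using n by (simp_all add: divide_simps)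
  then have \<theta>: "0 < \<theta>" "\<theta> < pi / 2" by (simp_all add: \<theta>_def)
  have a: "0 < a" using \<theta> by (simp add: a_def tan_gt_zero)
  have arctan_a: "arctan a = \<theta>" using \<theta> by (simp add: a_def arctan_tan)
  have g_inf: "g_inf = n * pi / 2 - pi / 4"
    using n by (simp add: g_inf_def \<theta>_def field_simps)
  have f: "0 < f x" "f x \<le> pi / 8" for x
    using one_plus_inner_pos[of x] by (simp_all add: f_def inverse_le_1_iff)
  have npi: "n * pi \<ge> 3 * pi" using n by simp
  have g_lower: "g x > (n - 1) * pi / 2" for x
    using f[of x] g_inf by (simp add: g_def algebra_simps diff_divide_distrib)
  have g_upper: "g x < n * pi / 2" for x
    using f(2)[of x] g_inf pi_gt_zero unfolding g_def by linarith
  have gap: "(n - 2) * pi / 2 < (n - 1) * pi / 2" "0 < (n - 1) * pi / 2" using n by simp_all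
  have fs: "symbol (- 2) f"
    unfolding f_def using symbol.mult[OF symbol.const[of "pi / 8"] symbol.bracket]
    by (simp only: add_0)
  have gs: "symbol 0 g"
    unfolding g_def by (intro symbol.add symbol.const symbol.weaken[OF fs]) simp
  have range: "\<bar>g x\<bar> \<in> {(n - 2) * pi / 2 <..< n * pi / 2}" for x
  proof -
    have "\<bar>g x\<bar> = g x" using g_lower[of x] gap(2) by linarith
    then show ?thesis using g_lower[of x] g_upper[of x] gap(1) unfolding greaterThanLessThan_iff by linarith
  qed
  have "\<bar>g_inf\<bar> > (n - 2) * pi / 2"
    using g_inf npi pi_gt_zero by (simp add: left_diff_distrib)
  moreover have "eq_up_to_O_m m \<beta> g g_inf"
    unfolding eq_up_to_O_m_def g_def
    using symbol_deriv_norm_decay[OF fs, of "- \<beta>"] assms(3) by simp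
  moreover have "(g \<longlongrightarrow> g_inf) at_infinity"
  proof -
    have "((\<lambda>x :: real^'n. inverse (1 + x \<bullet> x)) \<longlongrightarrow> 0) at_infinity"
      by (rule tendsto_inverse_0_at_top[OF filterlim_one_plus_inner])
    then have "(f \<longlongrightarrow> pi / 8 * 0) at_infinity" unfolding f_def by (rule tendsto_mult_left)
    then show ?thesis unfolding g_def by (auto intro!: tendsto_eq_intros)
  qed
  moreover have "transpose A = A" by (simp add: A_def transpose_mat)
  moreover have E: "eigenvalues A = replicate_mset CARD('n) a"
    by (simp add: A_def eigenvalues_mat)
  then have "arctan_sum A = g_inf"
    by (simp add: arctan_sum_def arctan_a g_inf_def n_def)
  moreover have "0 \<notin># eigenvalues A" using E a by simp
  moreover have "M A > 1"
  proof -
    have S: "(\<Sum>l\<in>#eigenvalues A. l / (1 + l\<^sup>2)) = n * (a / (1 + a\<^sup>2))"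
      by (simp add: E n_def)
    have "{(1 + b\<^sup>2) / (2 * d) * (\<Sum>l\<in>#eigenvalues A. l / (1 + l\<^sup>2)) | b d.
        b \<in># eigenvalues A \<and> d \<in># eigenvalues A} = {(1 + a\<^sup>2) / (2 * a) * (n * (a / (1 + a\<^sup>2)))}"
      unfolding S by (auto simp: E)
    then have "M A = (1 + a\<^sup>2) / (2 * a) * (n * (a / (1 + a\<^sup>2)))" by (simp add: M_def)
    also have "\<dots> = n / 2"
      using a sum_power2_gt_zero_iff[of 1 a] by (simp add: divide_simps)
    finally show ?thesis using n by simp
  qed
  moreover have False if u: "classical_solution g u"
    and asym: "(\<lambda>x. u x - 1 / 2 * (x \<bullet> (A *v x))) \<in> o[at_infinity](\<lambda>_. 1)"
    for u :: "real^'n \<Rightarrow> real"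
  proof -
    \<comment> \<open>The factor undoes the slope \<open>1 / (1 + a\<^sup>2)\<close> of \<open>arctan\<close> at \<open>a\<close>.\<close>
    define c where "c = pi / 8 * (1 + a\<^sup>2)"
    have a2: "1 + a\<^sup>2 > 0" by (simp add: add_pos_nonneg)
    then have c: "0 < c" by (simp add: c_def)
    have "A *v x = a *\<^sub>R x" for x
      by (simp add: A_def vec_eq_iff matrix_vector_mult_def mat_def if_distrib[of "\<lambda>y. y * _"]
          cong: if_cong)
    then have "(\<lambda>x. u x - a / 2 * (x \<bullet> x)) \<in> o[at_infinity](\<lambda>_. 1)" using asym by simp
    then obtain x where x: "trace (hessian u x) < n * a + c / (1 + x \<bullet> x)"
      using exists_small_laplacian[of u c a] u c unfolding classical_solution_def n_def by blast
    have H: "arctan_sum (hessian u x) = g x" using u by (simp add: classical_solution_def)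
    have "g x \<le> g_inf + (trace (hessian u x) - n * a) / (1 + a\<^sup>2)"
      using arctan_sum_le_trace[of "hessian u x" a] a g_lower[of x]
      by (simp add: H arctan_a g_inf_def n_def)
    also have "\<dots> < g_inf + (c / (1 + x \<bullet> x)) / (1 + a\<^sup>2)"
      using x a2 by (intro add_strict_left_mono divide_strict_right_mono) auto
    also have "\<dots> = g x"
    proof -
      have "(p * d / q) / d = p * inverse q" if "d > 0" for p q d :: real
        using that by (simp add: divide_inverse)
      then show ?thesis unfolding g_def f_def c_def by (simp only: a2)
    qed
    finally show False by simp
  qed
  ultimately show ?thesis
    using range symbol_C_class[OF gs, of m] unfolding n_def by blast
qed

end
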